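(* Let $k$ be a field, let $X$ be a finite set, fix a monomial order on $\mathrm{NF}(X)$, and let $I$ be an ideal of the free bicommutative algebra $\mathrm{BC}(X)$ over $k$. Then there exists a finite Gröbner–Shirshov basis for $\mathrm{BC}(X)/I$.
   Context: A (nonassociative, not necessarily unital) algebra over a field $k$ is bicommutative if $x(yz)=y(xz)$ and $(xy)z=(xz)y$ hold identically. $\mathrm{BC}(X)$ is the free bicommutative algebra generated by $X$. $\mathbb N$ is the set of nonnegative integers. $[X]$ is the free commutative monoid on $X$, $[X]^+$ the free commutative semigroup ($[X]$ without its unit). Notation: $[a_1,\dots,a_n]_L=(\cdots((a_1a_2)a_3)\cdots a_n)$ and $[a_1,\dots,a_n]_R=(a_1(a_2\cdots(a_{n-1}a_n)\cdots))$, with $[a_1]_L=[a_1]_R=a_1$. For $u=z_1\cdots z_p$, $v=y_1\cdots y_q\in[X]^+$ ($z_i,y_j\in X$, $p,q\ge1$), $[u;v]=[z_1,\dots,z_{p-1},[z_p,y_1,\dots,y_q]_L]_R\in \mathrm{BC}(X)$; this does not depend on the ordering of the $z_i$ or of the $y_j$. $\mathrm{NF}(X)=X\cup\{[u;v]\mid u,v\in[X]^+\}$ is a linear basis of $\mathrm{BC}(X)$ with multiplication $(zy)=[z;y]$, $(z[u;v])=[zu;v]$, $([u;v]z)=[u;vz]$, $([u;v][u';v'])=[uu';vv']$ for $z,y\in X$. The length is $\ell(x)=1$ for $x\in X$ and $\ell([u;v])=\ell(u)+\ell(v)$, where $\ell(u)$ is the number of letters of $u$ with repetition. A monomial order on $\mathrm{NF}(X)$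 is a well order $<$ such that $\mu<\nu$ implies $(\mu\nu')<(\nu\nu')$ and $(\nu'\mu)<(\nu'\nu)$ for all $\mu,\nu,\nu'\in\mathrm{NF}(X)$. For nonzero $f\in\mathrm{BC}(X)$, $\bar f$ is the largest element of $\mathrm{NF}(X)$ occurring in $f$; $f$ is monic if the coefficient of $\bar f$ is $1$. A set is monic if all its elements are nonzero and monic (the empty set is monic). Normal $S$-polynomials, for a monic set $S$: every $s\in S$ is one; and if $s\in S$ with $\ell(\bar s)\ge2$, then $[z_1,\dots,z_p,[s,y_1,\dots,y_q]_L]_R$ is one for all $p,q\in\mathbb N$, $z_i,y_j\in X$. For a (two-sided) ideal $I$, a monic set $S$ is a Gröbner–Shirshov basis for $\mathrm{BC}(X)/I$ if the ideal $\mathrm{Id}(S)$ generated by $S$ equals $I$ and every nonzero $f\in I$ satisfies $\bar f=\bar h$ for some normal $S$-polynomial $h$. *)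

theory Defs
  imports Complex_Main "HOL-Library.Poly_Mapping" "HOL-Library.Multiset"
begin

section \<open>Nonassociative algebras, iterated products\<close>

locale bicommutative_algebra = vector_space scale
  for scale :: "'k::field \<Rightarrow> 'a::ab_group_add \<Rightarrow> 'a" (infixr \<open>*s\<close> 75) +
  fixes mult :: "'a \<Rightarrow> 'a \<Rightarrow> 'a" (infixl \<open>\<star>\<close> 70)
  assumes mult_add_left: "(a + b) \<star> c = a \<star> c + b \<star> c"
    and mult_add_right: "a \<star> (b + c) = a \<star> b + a \<star> c"
    and mult_scale_left: "(r *s a) \<star> b = r *s (a \<star> b)"
    and mult_scale_right: "a \<star> (r *s b) = r *s (a \<star> b)"
    and left_comm: "a \<star> (b \<star> c) = b \<star> (a \<star> c)"
    and right_comm: "(a \<star> b) \<star> c = (a \<star> c) \<star> b"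

text \<open>The products \<open>[a\<^sub>1,\<dots>,a\<^sub>n]\<^sub>L\<close> and \<open>[a\<^sub>1,\<dots>,a\<^sub>n]\<^sub>R\<close>; the empty list is a
  junk case that is never used.\<close>

fun lbracket :: "('a \<Rightarrow> 'a \<Rightarrow> 'a) \<Rightarrow> 'a list \<Rightarrow> 'a" where
  "lbracket m [] = undefined"
| "lbracket m (a # as) = foldl m a as"

fun rbracket :: "('a \<Rightarrow> 'a \<Rightarrow> 'a) \<Rightarrow> 'a list \<Rightarrow> 'a" where
  "rbracket m [] = undefined"
| "rbracket m [a] = a"
| "rbracket m (a # b # as) = m a (rbracket m (b # as))"

section \<open>The free bicommutative algebra\<close>

text \<open>The set of normal forms \<open>NF X\<close> consists of the generators and of the symbols
  \<open>[u;v]\<close> with \<open>u\<close>, \<open>v\<close> in the free commutative semigroup on \<open>X\<close>, that is, nonempty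
  finite multisets over \<open>X\<close>. Symbols with an empty component exist in the datatype,
  but they are not in \<open>NF X\<close>.\<close>

datatype 'x nf = Gen 'x | Br "'x multiset" "'x multiset"

definition NF :: "'x set \<Rightarrow> 'x nf set" where
  "NF X = Gen ` X \<union> {Br u v | u v. u \<noteq> {#} \<and> v \<noteq> {#} \<and> set_mset u \<subseteq> X \<and> set_mset v \<subseteq> X}"

fun nf_mult :: "'x nf \<Rightarrow> 'x nf \<Rightarrow> 'x nf" where
  "nf_mult (Gen z) (Gen y) = Br {#z#} {#y#}"
| "nf_mult (Gen z) (Br u v) = Br (add_mset z u) v"
| "nf_mult (Br u v) (Gen z) = Br u (add_mset z v)"
| "nf_mult (Br u v) (Br u' v') = Br (u + u') (v + v')"

fun nf_length :: "'x nf \<Rightarrow> nat" where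
  "nf_length (Gen x) = 1"
| "nf_length (Br u v) = size u + size v"

text \<open>\<open>BC(X)\<close> is the vector space with basis \<open>NF X\<close>, with the bilinear product that
  extends \<^const>\<open>nf_mult\<close>. The theorems \<open>BC_bracket\<close>, \<open>BC_free_exists\<close> and
  \<open>BC_free_unique\<close> below show that this is the free bicommutative algebra generated by
  \<open>X\<close>, and that the basis symbol \<open>Br u v\<close> is the element \<open>[u;v]\<close> of it.\<close>

type_synonym ('x, 'k) bc = "'x nf \<Rightarrow>\<^sub>0 'k"

definition BC :: "'x set \<Rightarrow> ('x, 'k::field) bc set" where
  "BC X = {f. Poly_Mapping.keys f \<subseteq> NF X}"

definition bc_scale :: "'k::field \<Rightarrow> ('x, 'k) bc \<Rightarrow> ('x, 'k) bc" where
  "bc_scale c f = Poly_Mapping.map ((*) c) f"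

definition bc_mult :: "('x, 'k::field) bc \<Rightarrow> ('x, 'k) bc \<Rightarrow> ('x, 'k) bc" where
  "bc_mult f g = (\<Sum>\<mu>\<in>Poly_Mapping.keys f. \<Sum>\<nu>\<in>Poly_Mapping.keys g.
     Poly_Mapping.single (nf_mult \<mu> \<nu>) (Poly_Mapping.lookup f \<mu> * Poly_Mapping.lookup g \<nu>))"

definition bc_gen :: "'x \<Rightarrow> ('x, 'k::field) bc" where
  "bc_gen x = Poly_Mapping.single (Gen x) 1"

lemma lookup_bc_scale [simp]: "Poly_Mapping.lookup (bc_scale c f) k = c * Poly_Mapping.lookup f k"
  by (simp add: bc_scale_def map.rep_eq when_def)

interpretation bcv: vector_space "bc_scale :: 'k::field \<Rightarrow> ('x, 'k) bc \<Rightarrow> ('x, 'k) bc"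
  by unfold_locales (auto intro!: poly_mapping_eqI simp: lookup_add algebra_simps)

lemma bc_scale_single [simp]:
  "bc_scale c (Poly_Mapping.single k d) = Poly_Mapping.single k (c * d)"
  by (rule poly_mapping_eqI) (simp add: lookup_single when_def)

lemma poly_mapping_additive_induct:
  assumes "P 0" "\<And>k c. P (Poly_Mapping.single k c)" "\<And>f g. P f \<Longrightarrow> P g \<Longrightarrow> P (f + g)"
  shows "P (f :: 'a \<Rightarrow>\<^sub>0 'b::comm_monoid_add)"
proof -
  have "f = (\<Sum>k\<in>Poly_Mapping.keys f. Poly_Mapping.single k (Poly_Mapping.lookup f k))"
    by (rule poly_mapping_eqI)
      (simp add: lookup_sum lookup_single when_def in_keys_iff if_distrib cong: if_cong)
  moreover have "P (\<Sum>k\<in>A. Poly_Mapping.single k (Poly_Mapping.lookup f k))" if "finite A" for A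
    using that by induction (auto intro: assms)
  ultimately show ?thesis
    by (metis finite_keys)
qed

definition lin_ext ::
  "('k \<Rightarrow> 'b \<Rightarrow> 'b) \<Rightarrow> ('i \<Rightarrow> 'b) \<Rightarrow> ('i \<Rightarrow>\<^sub>0 'k::zero) \<Rightarrow> 'b::comm_monoid_add" where
  "lin_ext s F f = (\<Sum>i\<in>Poly_Mapping.keys f. s (Poly_Mapping.lookup f i) (F i))"

context vector_space
begin

lemma lin_ext_superset:
  assumes "finite A" "Poly_Mapping.keys f \<subseteq> A"
  shows "lin_ext scale F f = (\<Sum>i\<in>A. Poly_Mapping.lookup f i *s F i)"
  unfolding lin_ext_def using assms
  by (intro sum.mono_neutral_left) (auto simp: in_keys_iff)

lemma lin_ext_add: "lin_ext scale F (f + g) = lin_ext scale F f + lin_ext scale F g"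
proof -
  have "Poly_Mapping.keys (f + g) \<subseteq> Poly_Mapping.keys f \<union> Poly_Mapping.keys g" by (rule keys_add)
  then show ?thesis
    by (simp add: lin_ext_superset[of "Poly_Mapping.keys f \<union> Poly_Mapping.keys g"] lookup_add scale_left_distrib
        sum.distrib)
qed

lemma lin_ext_zero [simp]: "lin_ext scale F 0 = 0"
  by (simp add: lin_ext_def)

lemma lin_ext_single [simp]: "lin_ext scale F (Poly_Mapping.single i c) = c *s F i"
  by (simp add: lin_ext_superset[of "{i}"])

lemma lin_ext_fun_add: "lin_ext scale (\<lambda>i. F i + G i) f = lin_ext scale F f + lin_ext scale G f"
  by (simp add: lin_ext_def scale_right_distrib sum.distrib)

lemma lin_ext_fun_scale: "lin_ext scale (\<lambda>i. c *s F i) f = c *s lin_ext scale F f"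
  by (simp add: lin_ext_def scale_sum_right mult.commute)

end

lemma (in vector_space) lin_ext_scale: "lin_ext scale F (bc_scale c f) = c *s lin_ext scale F f"
proof -
  have "Poly_Mapping.keys (bc_scale c f) \<subseteq> Poly_Mapping.keys f"
    by (auto simp: in_keys_iff)
  then show ?thesis
    by (simp add: lin_ext_superset[of "Poly_Mapping.keys f"] scale_sum_right)
qed

lemma bc_mult_lin_ext:
  "bc_mult f g = lin_ext bc_scale (\<lambda>\<mu>. lin_ext bc_scale (\<lambda>\<nu>. Poly_Mapping.single (nf_mult \<mu> \<nu>) 1) g) f"
  by (simp add: bc_mult_def lin_ext_def bcv.scale_sum_right)

lemma bc_mult_single [simp]:
  "bc_mult (Poly_Mapping.single \<mu> c) (Poly_Mapping.single \<nu> d)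
     = Poly_Mapping.single (nf_mult \<mu> \<nu>) (c * d)"
  by (simp add: bc_mult_lin_ext)

lemma bc_mult_add_left: "bc_mult (a + b) c = bc_mult a c + bc_mult b c"
  by (simp add: bc_mult_lin_ext bcv.lin_ext_add)

lemma bc_mult_add_right: "bc_mult a (b + c) = bc_mult a b + bc_mult a c"
  by (simp add: bc_mult_lin_ext bcv.lin_ext_add bcv.lin_ext_fun_add)

lemma bc_mult_zero [simp]: "bc_mult 0 f = 0" "bc_mult f 0 = 0"
  by (simp_all add: bc_mult_def)

lemma nf_mult_left_comm: "nf_mult a (nf_mult b c) = nf_mult b (nf_mult a c)"
  by (cases a; cases b; cases c) (auto simp: ac_simps add_mset_commute)

lemma nf_mult_right_comm: "nf_mult (nf_mult a b) c = nf_mult (nf_mult a c) b"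
  by (cases a; cases b; cases c) (auto simp: ac_simps add_mset_commute)

lemma bc_left_comm: "bc_mult a (bc_mult b c) = bc_mult b (bc_mult a c)"
proof (induction a rule: poly_mapping_additive_induct)
  case (2 k r)
  show ?case
  proof (induction b rule: poly_mapping_additive_induct)
    case (2 k' r')
    show ?case
    proof (induction c rule: poly_mapping_additive_induct)
      case (2 k'' r'')
      show ?case by (simp add: nf_mult_left_comm mult.left_commute)
    qed (simp_all add: bc_mult_add_right)
  qed (simp_all add: bc_mult_add_right bc_mult_add_left)
qed (simp_all add: bc_mult_add_right bc_mult_add_left)

lemma bc_right_comm: "bc_mult (bc_mult a b) c = bc_mult (bc_mult a c) b"
proof (induction a rule: poly_mapping_additive_induct)
  case (2 k r)
  show ?case
  proof (induction b rule: poly_mapping_additive_induct)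
    case (2 k' r')
    show ?case
    proof (induction c rule: poly_mapping_additive_induct)
      case (2 k'' r'')
      show ?case by (simp add: nf_mult_right_comm[of k k'] ac_simps)
    qed (simp_all add: bc_mult_add_right bc_mult_add_left)
  qed (simp_all add: bc_mult_add_right bc_mult_add_left)
qed (simp_all add: bc_mult_add_right bc_mult_add_left)

lemma bc_mult_scale_left: "bc_mult (bc_scale c a) b = bc_scale c (bc_mult a b)"
  by (simp add: bc_mult_lin_ext bcv.lin_ext_scale)

lemma bc_mult_scale_right: "bc_mult a (bc_scale c b) = bc_scale c (bc_mult a b)"
  by (simp add: bc_mult_lin_ext bcv.lin_ext_scale bcv.lin_ext_fun_scale)

interpretation bc: bicommutative_algebra
  "bc_scale :: 'k::field \<Rightarrow> ('x, 'k) bc \<Rightarrow> ('x, 'k) bc" bc_mult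
  by unfold_locales
    (fact bc_mult_add_left bc_mult_add_right bc_mult_scale_left bc_mult_scale_right
      bc_left_comm bc_right_comm)+

lemma nf_mult_NF: "\<mu> \<in> NF X \<Longrightarrow> \<nu> \<in> NF X \<Longrightarrow> nf_mult \<mu> \<nu> \<in> NF X"
  by (cases \<mu>; cases \<nu>) (auto simp: NF_def)

lemma BC_subspace: "bcv.subspace (BC X)"
  by (simp add: bcv.subspace_def BC_def in_keys_iff lookup_add subset_iff) (metis add_0)

lemma BC_mult_closed:
  assumes "f \<in> BC X" "g \<in> BC X"
  shows "bc_mult f g \<in> BC X"
  unfolding bc_mult_def using assms
  by (intro bcv.subspace_sum[OF BC_subspace]) (auto simp: BC_def intro: nf_mult_NF)

lemma BC_gen: "x \<in> X \<Longrightarrow> bc_gen x \<in> BC X"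
  by (simp add: BC_def NF_def bc_gen_def)

text \<open>For words \<open>zs\<close>, \<open>ys\<close> this is \<open>[z\<^sub>1,\<dots>,[z\<^sub>p,y\<^sub>1,\<dots>,y\<^sub>q]\<^sub>L]\<^sub>R\<close>.\<close>

definition bracket :: "('a \<Rightarrow> 'a \<Rightarrow> 'a) \<Rightarrow> 'a list \<Rightarrow> 'a list \<Rightarrow> 'a" where
  "bracket m zs ys = rbracket m (butlast zs @ [lbracket m (last zs # ys)])"

lemma rbracket_snoc: "rbracket m (zs @ [a]) = foldr m zs a"
  by (induction zs rule: induct_list012) auto

context bicommutative_algebra
begin

lemma foldr_left_comm: "x \<star> foldr (\<star>) zs a = foldr (\<star>) zs (x \<star> a)"
  by (induction zs) (simp_all add: left_comm)

lemma foldl_right_comm: "foldl (\<star>) a ys \<star> y = foldl (\<star>) (a \<star> y) ys"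
  by (induction ys arbitrary: a) (simp_all add: right_comm)

lemma left_right_comm: "x \<star> ((a \<star> b) \<star> z) = (x \<star> (a \<star> b)) \<star> z"
proof -
  have "x \<star> ((a \<star> b) \<star> z) = (a \<star> z) \<star> (x \<star> b)"
    by (simp add: right_comm[of a b z] left_comm)
  also have "\<dots> = (a \<star> (x \<star> b)) \<star> z"
    by (rule right_comm)
  finally show ?thesis
    by (simp add: left_comm)
qed

lemma left_foldl_comm: "x \<star> foldl (\<star>) (a \<star> b) ys = foldl (\<star>) (x \<star> (a \<star> b)) ys"
proof (induction ys arbitrary: a b)
  case (Cons y ys)
  show ?case
    using Cons[of "a \<star> b" y] by (simp add: left_right_comm)
qed simp

lemma foldr_foldl_comm:
  "foldr (\<star>) zs (foldl (\<star>) (a \<star> b) ys) = foldl (\<star>) (foldr (\<star>) zs (a \<star> b)) ys"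
proof (induction zs)
  case (Cons z zs)
  obtain c d where "foldr (\<star>) zs (a \<star> b) = c \<star> d"
    by (cases zs) auto
  then show ?case
    using Cons by (simp add: left_foldl_comm)
qed simp

lemma bracket_alt:
  assumes "zs \<noteq> []"
  shows "bracket (\<star>) zs (y # ys) = foldl (\<star>) (foldr (\<star>) zs y) ys"
proof -
  have "foldr (\<star>) zs y = foldr (\<star>) (butlast zs @ [last zs]) y"
    using assms by simp
  then show ?thesis
    by (simp only: foldr_append) (simp add: bracket_def rbracket_snoc foldr_foldl_comm)
qed

lemma bracket_mset_cong:
  assumes "mset zs = mset zs'" "mset ys = mset ys'" "zs \<noteq> []" "ys \<noteq> []"
  shows "bracket (\<star>) zs ys = bracket (\<star>) zs' ys'"
proof -
  have l: "foldr (\<star>) us a = foldr (\<star>) us' a" if "mset us = mset us'" for us us' a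
    using fold_multiset_equiv[of "rev us" "(\<star>)" "rev us'"] that
    by (simp add: foldr_conv_fold fun_eq_iff left_comm)
  have r: "foldl (\<star>) a us = foldl (\<star>) a us'" if "mset us = mset us'" for us us' a
    using fold_multiset_equiv[of us "\<lambda>y a. a \<star> y" us'] that
    by (simp add: foldl_conv_fold fun_eq_iff right_comm)
  have z': "zs' \<noteq> []" using assms by auto
  obtain y us where ys: "ys = y # us" using assms by (cases ys) auto
  obtain y' us' where ys': "ys' = y' # us'" using assms by (cases ys') auto
  have "bracket (\<star>) zs ys = foldr (\<star>) (butlast zs') (foldl (\<star>) (last zs') ys)"
    using bracket_alt[OF assms(3), of y us] bracket_alt[OF z', of y us] l[OF assms(1)]
    by (simp add: ys bracket_def rbracket_snoc)
  also have "\<dots> = bracket (\<star>) zs' ys'"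
    using r[OF assms(2)] by (simp add: bracket_def rbracket_snoc)
  finally show ?thesis .
qed

lemma bracket_single: "bracket (\<star>) [z] [y] = z \<star> y"
  by (simp add: bracket_def)

lemma bracket_Cons: "zs \<noteq> [] \<Longrightarrow> ys \<noteq> [] \<Longrightarrow> bracket (\<star>) (z # zs) ys = z \<star> bracket (\<star>) zs ys"
  using rbracket_snoc[of "(\<star>)" "z # butlast zs"] by (simp add: bracket_def rbracket_snoc)

lemma bracket_append:
  "zs \<noteq> [] \<Longrightarrow> ys \<noteq> [] \<Longrightarrow> bracket (\<star>) (zs' @ zs) ys = foldr (\<star>) zs' (bracket (\<star>) zs ys)"
  by (induction zs') (simp_all add: bracket_Cons)

lemma bracket_append_right:
  "zs \<noteq> [] \<Longrightarrow> ys \<noteq> [] \<Longrightarrow> bracket (\<star>) zs (ys @ ys') = foldl (\<star>) (bracket (\<star>) zs ys) ys'"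
  by (cases ys) (simp_all add: bracket_alt)

lemma bracket_mult:
  assumes "zs \<noteq> []" "ys \<noteq> []" "zs' \<noteq> []" "ys' \<noteq> []"
  shows "bracket (\<star>) zs ys \<star> bracket (\<star>) zs' ys' = bracket (\<star>) (zs @ zs') (ys @ ys')"
proof -
  obtain y us where ys: "ys = y # us" using assms by (cases ys) auto
  obtain z ws where zs: "zs = z # ws" using assms by (cases zs) auto
  define Q where "Q = bracket (\<star>) zs' ys'"
  have "bracket (\<star>) zs ys \<star> Q = foldl (\<star>) ((z \<star> foldr (\<star>) ws y) \<star> Q) us"
    using assms(1) by (simp add: ys bracket_alt foldl_right_comm zs)
  also have "(z \<star> foldr (\<star>) ws y) \<star> Q = foldr (\<star>) ws ((z \<star> Q) \<star> y)"
    by (subst right_comm) (rule foldr_left_comm)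
  also have "z \<star> Q = bracket (\<star>) (z # zs') ys'"
    using assms by (simp add: Q_def bracket_Cons)
  also have "\<dots> \<star> y = bracket (\<star>) (z # zs') (ys' @ [y])"
    using assms by (simp add: bracket_append_right)
  also have "foldr (\<star>) ws \<dots> = bracket (\<star>) (ws @ z # zs') (ys' @ [y])"
    by (simp add: bracket_append)
  also have "foldl (\<star>) \<dots> us = bracket (\<star>) (ws @ z # zs') (ys' @ y # us)"
    by (simp flip: bracket_append_right)
  also have "\<dots> = bracket (\<star>) (zs @ zs') (ys @ ys')"
    by (rule bracket_mset_cong) (simp_all add: zs ys)
  finally show ?thesis unfolding Q_def .
qed

definition BC_hom :: "'x set \<Rightarrow> (('x, 'k) bc \<Rightarrow> 'a) \<Rightarrow> bool" where
  "BC_hom X \<phi> \<longleftrightarrow>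
     (\<forall>f\<in>BC X. \<forall>h\<in>BC X. \<phi> (f + h) = \<phi> f + \<phi> h) \<and>
     (\<forall>c. \<forall>f\<in>BC X. \<phi> (bc_scale c f) = c *s \<phi> f) \<and>
     (\<forall>f\<in>BC X. \<forall>h\<in>BC X. \<phi> (bc_mult f h) = \<phi> f \<star> \<phi> h)"

end

theorem BC_bracket:
  assumes "zs \<noteq> []" "ys \<noteq> []"
  shows "bracket bc_mult (map bc_gen zs) (map bc_gen ys)
    = (Poly_Mapping.single (Br (mset zs) (mset ys)) 1 :: ('x, 'k::field) bc)"
  using assms
proof (induction zs rule: list_nonempty_induct)
  case (single z)
  show ?case
    using single
  proof (induction ys rule: rev_nonempty_induct)
    case (single y)
    show ?case by (simp add: bc.bracket_single) (simp add: bc_gen_def)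
  next
    case (snoc y ys)
    then show ?case by (simp add: bc.bracket_append_right) (simp add: bc_gen_def)
  qed
next
  case (cons z zs)
  then show ?case by (simp add: bc.bracket_Cons) (simp add: bc_gen_def)
qed

lemma NF_cases:
  assumes "\<mu> \<in> NF X"
  obtains (gen) x where "x \<in> X" "\<mu> = Gen x"
  | (br) zs ys where "zs \<noteq> []" "ys \<noteq> []" "set zs \<subseteq> X" "set ys \<subseteq> X"
      "\<mu> = Br (mset zs) (mset ys)"
proof -
  consider x where "x \<in> X" "\<mu> = Gen x"
    | u v where "u \<noteq> {#}" "v \<noteq> {#}" "set_mset u \<subseteq> X" "set_mset v \<subseteq> X" "\<mu> = Br u v"
    using assms by (auto simp: NF_def)
  then show ?thesis
  proof cases
    case 1
    then show ?thesis by (rule gen)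
  next
    case 2
    obtain zs ys where "mset zs = u" "mset ys = v" by (metis ex_mset)
    with 2 show ?thesis by (intro br[of zs ys]) auto
  qed
qed

context bicommutative_algebra
begin

fun nf_eval :: "('x \<Rightarrow> 'a) \<Rightarrow> 'x nf \<Rightarrow> 'a" where
  "nf_eval g (Gen x) = g x"
| "nf_eval g (Br u v) =
     bracket (\<star>) (map g (SOME zs. mset zs = u)) (map g (SOME ys. mset ys = v))"

lemma nf_eval_Br:
  assumes "zs \<noteq> []" "ys \<noteq> []"
  shows "nf_eval g (Br (mset zs) (mset ys)) = bracket (\<star>) (map g zs) (map g ys)"
proof -
  have *: "mset (SOME us. mset us = mset ws) = mset ws" for ws :: "'x list"
    by (rule someI[of "\<lambda>us. mset us = mset ws"]) simp
  show ?thesis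
    unfolding nf_eval.simps
  proof (rule bracket_mset_cong)
    show "map g (SOME us. mset us = mset zs) \<noteq> []" "map g (SOME us. mset us = mset ys) \<noteq> []"
      using *[of zs] *[of ys] assms by auto
  qed (simp_all add: *)
qed

lemma nf_eval_mult:
  assumes "\<mu> \<in> NF X" "\<nu> \<in> NF X"
  shows "nf_eval g (nf_mult \<mu> \<nu>) = nf_eval g \<mu> \<star> nf_eval g \<nu>"
  using assms(1)
proof (cases rule: NF_cases)
  case (gen x)
  from assms(2) show ?thesis
  proof (cases rule: NF_cases)
    case (gen y)
    with \<open>\<mu> = Gen x\<close> show ?thesis
      using nf_eval_Br[of "[x]" "[y]" g] by (simp add: bracket_single del: nf_eval.simps(2))
  next
    case (br zs ys)
    with \<open>\<mu> = Gen x\<close> show ?thesis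
      using nf_eval_Br[of "x # zs" ys g]
      by (simp add: nf_eval_Br bracket_Cons del: nf_eval.simps(2))
  qed
next
  case mu: (br zs ys)
  from assms(2) show ?thesis
  proof (cases rule: NF_cases)
    case (gen y)
    with mu show ?thesis
      using nf_eval_Br[of zs "ys @ [y]" g]
      by (simp add: nf_eval_Br bracket_append_right del: nf_eval.simps(2))
  next
    case (br zs' ys')
    with mu show ?thesis
      using nf_eval_Br[of "zs @ zs'" "ys @ ys'" g]
      by (simp add: nf_eval_Br bracket_mult del: nf_eval.simps(2))
  qed
qed

lemma lin_ext_sum: "lin_ext scale F (sum G A) = (\<Sum>i\<in>A. lin_ext scale F (G i))"
  by (induction A rule: infinite_finite_induct) (simp_all add: lin_ext_add)

lemma mult_zero [simp]: "0 \<star> a = 0" "a \<star> 0 = 0"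
  using mult_scale_left[of 0 0 a] mult_scale_right[of a 0 0] by simp_all

lemma mult_sum_left: "sum F A \<star> b = (\<Sum>i\<in>A. F i \<star> b)"
  by (induction A rule: infinite_finite_induct) (simp_all add: mult_add_left)

lemma mult_sum_right: "b \<star> sum F A = (\<Sum>i\<in>A. b \<star> F i)"
  by (induction A rule: infinite_finite_induct) (simp_all add: mult_add_right)

theorem BC_free_exists:
  fixes g :: "'x \<Rightarrow> 'a"
  shows "\<exists>\<phi>. BC_hom X \<phi> \<and> (\<forall>x\<in>X. \<phi> (bc_gen x) = g x)"
proof (intro exI conjI)
  let ?\<phi> = "lin_ext scale (nf_eval g)"
  have "?\<phi> (bc_mult f h) = ?\<phi> f \<star> ?\<phi> h" if "f \<in> BC X" "h \<in> BC X" for f h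
  proof -
    have "?\<phi> (bc_mult f h) = (\<Sum>\<mu>\<in>Poly_Mapping.keys f. \<Sum>\<nu>\<in>Poly_Mapping.keys h.
        (Poly_Mapping.lookup f \<mu> * Poly_Mapping.lookup h \<nu>) *s nf_eval g (nf_mult \<mu> \<nu>))"
      by (simp add: bc_mult_def lin_ext_sum)
    also have "\<dots> = (\<Sum>\<mu>\<in>Poly_Mapping.keys f. \<Sum>\<nu>\<in>Poly_Mapping.keys h.
        (Poly_Mapping.lookup f \<mu> *s nf_eval g \<mu>) \<star> (Poly_Mapping.lookup h \<nu> *s nf_eval g \<nu>))"
    proof (intro sum.cong refl)
      fix \<mu> \<nu> assume "\<mu> \<in> Poly_Mapping.keys f" "\<nu> \<in> Poly_Mapping.keys h"
      with that have "\<mu> \<in> NF X" "\<nu> \<in> NF X" by (auto simp: BC_def)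
      then show "(Poly_Mapping.lookup f \<mu> * Poly_Mapping.lookup h \<nu>) *s nf_eval g (nf_mult \<mu> \<nu>)
          = (Poly_Mapping.lookup f \<mu> *s nf_eval g \<mu>) \<star> (Poly_Mapping.lookup h \<nu> *s nf_eval g \<nu>)"
        by (simp add: nf_eval_mult mult_scale_left mult_scale_right)
    qed
    also have "\<dots> = ?\<phi> f \<star> ?\<phi> h"
      by (simp only: lin_ext_def mult_sum_left) (simp only: mult_sum_right)
    finally show ?thesis .
  qed
  then show "BC_hom X ?\<phi>"
    by (simp add: BC_hom_def lin_ext_add lin_ext_scale)
  show "\<forall>x\<in>X. ?\<phi> (bc_gen x) = g x"
    by (simp add: bc_gen_def)
qed

theorem BC_free_unique:
  assumes hom: "BC_hom X \<phi>" "BC_hom X \<psi>"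
    and gen: "\<And>x. x \<in> X \<Longrightarrow> \<phi> (bc_gen x) = \<psi> (bc_gen x)"
    and f: "f \<in> BC X"
  shows "\<phi> f = \<psi> f"
proof -
  define E where "E = {h \<in> BC X. \<phi> h = \<psi> h}"
  have zero: "0 \<in> BC X"
    by (simp add: BC_def)
  have zero_eq: "\<chi> 0 = 0" if "BC_hom X \<chi>" for \<chi>
  proof -
    have "\<chi> (bc_scale 0 0) = 0 *s \<chi> 0"
      using that zero unfolding BC_hom_def by blast
    then show ?thesis by simp
  qed
  have sub: "bcv.subspace E"
    using hom zero zero_eq[OF hom(1)] zero_eq[OF hom(2)] unfolding E_def BC_hom_def
    by (intro bcv.subspaceI)
      (simp_all add: bcv.subspace_add[OF BC_subspace] bcv.subspace_scale[OF BC_subspace])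
  have mult: "bc_mult a b \<in> E" if "a \<in> E" "b \<in> E" for a b
    using that hom by (auto simp: E_def BC_hom_def BC_mult_closed)
  have genE: "bc_gen x \<in> E" if "x \<in> X" for x
    using that by (simp add: E_def gen BC_gen)
  have "Poly_Mapping.single \<mu> 1 \<in> E" if "\<mu> \<in> NF X" for \<mu>
    using that
  proof (cases rule: NF_cases)
    case (gen x)
    then show ?thesis using genE by (simp add: bc_gen_def)
  next
    case (br zs ys)
    have L: "foldl bc_mult a (map bc_gen us) \<in> E" if "a \<in> E" "set us \<subseteq> X" for a us
      using that by (induction us arbitrary: a) (auto intro: mult genE)
    have R: "foldr bc_mult (map bc_gen us) a \<in> E" if "a \<in> E" "set us \<subseteq> X" for a us
      using that by (induction us) (auto intro: mult genE)
    have "set (butlast zs) \<subseteq> X" "last zs \<in> X"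
      using br by (auto dest: in_set_butlastD)
    then have "bracket bc_mult (map bc_gen zs) (map bc_gen ys) \<in> E"
      using br by (simp add: bracket_def rbracket_snoc L R genE last_map flip: map_butlast)
    then show ?thesis
      using br by (simp add: BC_bracket)
  qed
  then have "(\<Sum>\<mu>\<in>Poly_Mapping.keys f. bc_scale (Poly_Mapping.lookup f \<mu>) (Poly_Mapping.single \<mu> 1)) \<in> E"
    using f by (intro bcv.subspace_sum[OF sub] bcv.subspace_scale[OF sub]) (auto simp: BC_def)
  also have "(\<Sum>\<mu>\<in>Poly_Mapping.keys f. bc_scale (Poly_Mapping.lookup f \<mu>) (Poly_Mapping.single \<mu> 1)) = f"
    by (rule poly_mapping_eqI)
      (simp add: lookup_sum lookup_single when_def in_keys_iff if_distrib cong: if_cong)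
  finally show ?thesis by (simp add: E_def)
qed

end

section \<open>Ideals\<close>

definition BC_ideal :: "'x set \<Rightarrow> ('x, 'k::field) bc set \<Rightarrow> bool" where
  "BC_ideal X I \<longleftrightarrow> I \<subseteq> BC X \<and> module.subspace bc_scale I \<and>
     (\<forall>f\<in>BC X. \<forall>g\<in>I. bc_mult f g \<in> I \<and> bc_mult g f \<in> I)"

definition BC_Id :: "'x set \<Rightarrow> ('x, 'k::field) bc set \<Rightarrow> ('x, 'k) bc set" where
  "BC_Id X S = BC_ideal X hull S"

section \<open>Groebner-Shirshov bases\<close>

text \<open>A monomial order is given by its reflexive relation \<open>r\<close>; the strict order
  \<open>\<mu> < \<nu>\<close> is \<open>(\<mu>, \<nu>) \<in> r - Id\<close>.\<close>

definition monomial_order :: "'x set \<Rightarrow> 'x nf rel \<Rightarrow> bool" where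
  "monomial_order X r \<longleftrightarrow> well_order_on (NF X) r \<and>
     (\<forall>\<mu>\<in>NF X. \<forall>\<nu>\<in>NF X. \<forall>\<nu>'\<in>NF X. (\<mu>, \<nu>) \<in> r - Id \<longrightarrow>
        (nf_mult \<mu> \<nu>', nf_mult \<nu> \<nu>') \<in> r - Id \<and>
        (nf_mult \<nu>' \<mu>, nf_mult \<nu>' \<nu>) \<in> r - Id)"

definition lead :: "'x nf rel \<Rightarrow> ('x, 'k::field) bc \<Rightarrow> 'x nf" where
  "lead r f = (THE \<mu>. \<mu> \<in> Poly_Mapping.keys f \<and> (\<forall>\<nu>\<in>Poly_Mapping.keys f. (\<nu>, \<mu>) \<in> r))"

definition monic_set :: "'x nf rel \<Rightarrow> ('x, 'k::field) bc set \<Rightarrow> bool" where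
  "monic_set r S \<longleftrightarrow> (\<forall>s\<in>S. s \<noteq> 0 \<and> Poly_Mapping.lookup s (lead r s) = 1)"

inductive_set normal_polys ::
  "'x set \<Rightarrow> 'x nf rel \<Rightarrow> ('x, 'k::field) bc set \<Rightarrow> ('x, 'k) bc set"
  for X r S where
  base: "s \<in> S \<Longrightarrow> s \<in> normal_polys X r S"
| bracket: "s \<in> S \<Longrightarrow> nf_length (lead r s) \<ge> 2 \<Longrightarrow> set zs \<subseteq> X \<Longrightarrow> set ys \<subseteq> X \<Longrightarrow>
    rbracket bc_mult (map bc_gen zs @ [lbracket bc_mult (s # map bc_gen ys)])
      \<in> normal_polys X r S"

text \<open>The condition \<open>h \<noteq> 0\<close> only makes explicit that \<open>lead r h\<close> is meaningful.\<close>

definition GS_basis ::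
  "'x set \<Rightarrow> 'x nf rel \<Rightarrow> ('x, 'k::field) bc set \<Rightarrow> ('x, 'k) bc set \<Rightarrow> bool" where
  "GS_basis X r I S \<longleftrightarrow> S \<subseteq> BC X \<and> monic_set r S \<and> BC_Id X S = I \<and>
     (\<forall>f\<in>I. f \<noteq> 0 \<longrightarrow> (\<exists>h\<in>normal_polys X r S. h \<noteq> 0 \<and> lead r f = lead r h))"

end

theory Submission
  imports Defs
begin

text \<open>By Dickson's lemma, finitely many of the leading monomials \<open>[u;v]\<close> of \<open>I\<close> divide, in both
  components, all the others. Choose a monic element of \<open>I\<close> for each of them, and one for each
  leading monomial in \<open>X\<close>. Multiplying by generators on both sides multiplies leading monomials
  accordingly, so every leading monomial of \<open>I\<close> is that of a normal \<open>S\<close>-polynomial;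
  well-founded reduction then yields \<open>Id(S) = I\<close>.\<close>

section \<open>Dickson's lemma for families of coordinates and for pairs of multisets\<close>

text \<open>Induction on the set of coordinates. A finite set that dominates for \<open>K\<close>
  also handles the new coordinate \<open>j\<close> where that coordinate is large; the remaining
  elements fall into finitely many slices on which \<open>j\<close> is constant, and the induction
  hypothesis applies to each slice.\<close>

lemma dickson:
  fixes F :: "'i \<Rightarrow> 'a \<Rightarrow> nat"
  assumes "finite K"
  shows "\<exists>B\<subseteq>A. finite B \<and> (\<forall>a\<in>A. \<exists>b\<in>B. \<forall>i\<in>K. F i b \<le> F i a)"
  using assms
proof (induction K arbitrary: A rule: finite_induct)
  case empty
  show ?case
  proof (cases "A = {}")
    case False
    then obtain a where "a \<in> A" by blast
    then show ?thesis by (intro exI[of _ "{a}"]) auto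
  qed auto
next
  case (insert j K)
  obtain B where B: "B \<subseteq> A" "finite B" "\<forall>a\<in>A. \<exists>b\<in>B. \<forall>i\<in>K. F i b \<le> F i a"
    using insert.IH[of A] by blast
  \<comment> \<open>Every element with \<open>j\<close>-th coordinate at least \<open>N\<close> is
    above all of \<open>B\<close> in that coordinate; only the slices with \<open>k < N\<close> need
    sets of their own.\<close>
  obtain N where N: "\<forall>b\<in>B. F j b \<le> N"
    using B(2) by (metis finite_imageI finite_nat_set_iff_bounded_le imageI)
  have "\<forall>k. \<exists>B\<subseteq>{a \<in> A. F j a = k}. finite B \<and>
      (\<forall>a\<in>{a \<in> A. F j a = k}. \<exists>b\<in>B. \<forall>i\<in>K. F i b \<le> F i a)"
    using insert.IH by blast
  from choice[OF this] obtain C where "\<forall>k. C k \<subseteq> {a \<in> A. F j a = k} \<and> finite (C k) \<and>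
      (\<forall>a\<in>{a \<in> A. F j a = k}. \<exists>b\<in>C k. \<forall>i\<in>K. F i b \<le> F i a)"
    by (rule exE)
  then have C: "\<And>k. C k \<subseteq> {a \<in> A. F j a = k}" "\<And>k. finite (C k)"
      "\<And>k. \<forall>a\<in>{a \<in> A. F j a = k}. \<exists>b\<in>C k. \<forall>i\<in>K. F i b \<le> F i a"
    by simp_all
  have "\<exists>b\<in>B \<union> (\<Union>k<N. C k). \<forall>i\<in>insert j K. F i b \<le> F i a" if a: "a \<in> A" for a
  proof (cases "F j a < N")
    case True
    obtain b where b: "b \<in> C (F j a)" "\<forall>i\<in>K. F i b \<le> F i a"
      using C(3)[of "F j a"] a by blast
    moreover have "F j b = F j a" using C(1) b(1) by blast
    ultimately show ?thesis using True by (intro bexI[of _ b]) auto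
  next
    case False
    with B(3) N a show ?thesis
      by (metis UnI1 insert_iff le_trans linorder_not_less)
  qed
  moreover have "B \<union> (\<Union>k<N. C k) \<subseteq> A" using B(1) C(1) by blast
  moreover have "finite (B \<union> (\<Union>k<N. C k))" using B(2) C(2) by blast
  ultimately show ?case by blast
qed

lemma dickson_multiset_pairs:
  fixes A :: "('x multiset \<times> 'x multiset) set"
  assumes X: "finite X" and A: "\<And>u v. (u, v) \<in> A \<Longrightarrow> set_mset u \<subseteq> X \<and> set_mset v \<subseteq> X"
  shows "\<exists>B\<subseteq>A. finite B \<and> (\<forall>(u, v)\<in>A. \<exists>(u', v')\<in>B. u' \<subseteq># u \<and> v' \<subseteq># v)"
proof -
  \<comment> \<open>The coordinates are the multiplicities of letters; the boolean in the index
    selects the component of the pair.\<close>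
  let ?F = "\<lambda>(b, x) (u, v). count (if b then u else v) x"
  obtain B where B: "B \<subseteq> A" "finite B" "\<forall>a\<in>A. \<exists>b\<in>B. \<forall>i\<in>UNIV \<times> X. ?F i b \<le> ?F i a"
    using dickson[of "UNIV \<times> X" A ?F] X by auto
  have "\<exists>(u', v')\<in>B. u' \<subseteq># u \<and> v' \<subseteq># v" if uv: "(u, v) \<in> A" for u v
  proof -
    obtain u' v' where b: "(u', v') \<in> B" and le: "\<forall>i\<in>UNIV \<times> X. ?F i (u', v') \<le> ?F i (u, v)"
      using B(3) uv by fastforce
    have sub: "set_mset u' \<subseteq> X" "set_mset v' \<subseteq> X" using A B(1) b by blast+
    \<comment> \<open>Dickson's lemma compares only letters of \<open>X\<close>; outside
      \<open>X\<close> the counts of \<open>u'\<close> and \<open>v'\<close> vanish.\<close>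
    have "count u' x \<le> count u x \<and> count v' x \<le> count v x" for x
    proof (cases "x \<in> X")
      case True
      then show ?thesis using le[rule_format, of "(True, x)"] le[rule_format, of "(False, x)"] by simp
    next
      case False
      then have "count u' x = 0" "count v' x = 0"
        using sub by (auto simp: count_eq_zero_iff)
      then show ?thesis by simp
    qed
    then have "u' \<subseteq># u" "v' \<subseteq># v" by (simp_all add: subseteq_mset_def)
    with b show ?thesis by blast
  qed
  then show ?thesis using B(1,2) by (intro exI[of _ B]) auto
qed

section \<open>Leading monomials and multiplication by generators\<close>

lemma bc_mult_bc_gen_left:
  "bc_mult (bc_gen z) f
    = (\<Sum>\<nu>\<in>Poly_Mapping.keys f. Poly_Mapping.single (nf_mult (Gen z) \<nu>) (Poly_Mapping.lookup f \<nu>))"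
  by (simp add: bc_mult_def bc_gen_def)

lemma bc_mult_bc_gen_right:
  "bc_mult f (bc_gen z)
    = (\<Sum>\<nu>\<in>Poly_Mapping.keys f. Poly_Mapping.single (nf_mult \<nu> (Gen z)) (Poly_Mapping.lookup f \<nu>))"
  by (simp add: bc_mult_def bc_gen_def)

locale bc_monomial_order =
  fixes X :: "'x set" and r :: "'x nf rel"
  assumes monomial_order: "monomial_order X r"
begin

lemma well_order: "well_order_on (NF X) r"
  using monomial_order by (simp add: monomial_order_def)

lemma refl: "\<mu> \<in> NF X \<Longrightarrow> (\<mu>, \<mu>) \<in> r"
  using well_order by (auto simp: order_on_defs refl_on_def)

lemma trans: "(\<mu>, \<nu>) \<in> r \<Longrightarrow> (\<nu>, \<rho>) \<in> r \<Longrightarrow> (\<mu>, \<rho>) \<in> r"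
  using well_order by (auto simp: order_on_defs trans_def)

lemma antisym: "(\<mu>, \<nu>) \<in> r \<Longrightarrow> (\<nu>, \<mu>) \<in> r \<Longrightarrow> \<mu> = \<nu>"
  using well_order by (auto simp: order_on_defs antisym_def)

lemma total: "\<mu> \<in> NF X \<Longrightarrow> \<nu> \<in> NF X \<Longrightarrow> (\<mu>, \<nu>) \<in> r \<or> (\<nu>, \<mu>) \<in> r"
  using well_order refl by (fastforce simp: order_on_defs total_on_def)

lemma finite_has_greatest:
  assumes "finite A" "A \<noteq> {}" "A \<subseteq> NF X"
  shows "\<exists>\<mu>\<in>A. \<forall>\<nu>\<in>A. (\<nu>, \<mu>) \<in> r"
  using assms
proof (induction A rule: finite_ne_induct)
  case (singleton \<mu>)
  then show ?case using refl by simp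
next
  case (insert \<rho> A)
  then obtain \<mu> where \<mu>: "\<mu> \<in> A" "\<forall>\<nu>\<in>A. (\<nu>, \<mu>) \<in> r" by auto
  with insert.prems have "(\<rho>, \<mu>) \<in> r \<or> (\<mu>, \<rho>) \<in> r" "(\<rho>, \<rho>) \<in> r"
    using total[of \<rho> \<mu>] refl[of \<rho>] by blast+
  with \<mu> show ?case by (metis insert_iff trans)
qed

lemma lead_eqI:
  assumes "\<mu> \<in> Poly_Mapping.keys f" "\<And>\<nu>. \<nu> \<in> Poly_Mapping.keys f \<Longrightarrow> (\<nu>, \<mu>) \<in> r"
  shows "lead r f = \<mu>"
  unfolding lead_def using assms by (intro the_equality) (auto intro: antisym)

text \<open>Justifies the definite description in \<open>lead\<close>: a nonempty finite support in
  a total order has a greatest element.\<close>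

lemma lead_greatest:
  assumes "f \<in> BC X" "f \<noteq> 0"
  shows lead_in_keys: "lead r f \<in> Poly_Mapping.keys f"
    and le_lead: "\<nu> \<in> Poly_Mapping.keys f \<Longrightarrow> (\<nu>, lead r f) \<in> r"
proof -
  obtain \<mu> where "\<mu> \<in> Poly_Mapping.keys f" "\<forall>\<nu>\<in>Poly_Mapping.keys f. (\<nu>, \<mu>) \<in> r"
    using finite_has_greatest[of "Poly_Mapping.keys f"] assms by (auto simp: BC_def)
  then show "lead r f \<in> Poly_Mapping.keys f"
    and "\<nu> \<in> Poly_Mapping.keys f \<Longrightarrow> (\<nu>, lead r f) \<in> r"
    using lead_eqI by metis+
qed

lemma lead_in_NF: "f \<in> BC X \<Longrightarrow> f \<noteq> 0 \<Longrightarrow> lead r f \<in> NF X"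
  using lead_in_keys by (auto simp: BC_def)

lemma lead_scale: "c \<noteq> 0 \<Longrightarrow> lead r (bc_scale c f) = lead r f"
  by (simp add: lead_def in_keys_iff Ball_def)

text \<open>A strictly increasing map keeps the greatest key greatest and sends no other key to its
  image, so nothing cancels there. Left and right multiplication by a generator are both
  instances.\<close>

lemma lead_monotone_image:
  assumes f: "f \<in> BC X" "f \<noteq> 0"
    and mono: "\<And>\<mu> \<nu>. \<mu> \<in> NF X \<Longrightarrow> \<nu> \<in> NF X \<Longrightarrow> (\<mu>, \<nu>) \<in> r - Id \<Longrightarrow> (g \<mu>, g \<nu>) \<in> r - Id"
    and closed: "\<And>\<mu>. \<mu> \<in> NF X \<Longrightarrow> g \<mu> \<in> NF X"
  defines "h \<equiv> \<Sum>\<nu>\<in>Poly_Mapping.keys f. Poly_Mapping.single (g \<nu>) (Poly_Mapping.lookup f \<nu>)"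
  shows "h \<noteq> 0" "lead r h = g (lead r f)"
proof -
  have keys: "\<nu> \<in> NF X" if "\<nu> \<in> Poly_Mapping.keys f" for \<nu> using f that by (auto simp: BC_def)
  have less: "(g \<nu>, g (lead r f)) \<in> r - Id" if "\<nu> \<in> Poly_Mapping.keys f" "\<nu> \<noteq> lead r f" for \<nu>
    using that le_lead[OF f] lead_in_NF[OF f] keys by (intro mono) auto
  have "Poly_Mapping.lookup h (g (lead r f))
      = (\<Sum>\<nu>\<in>Poly_Mapping.keys f. if \<nu> = lead r f then Poly_Mapping.lookup f \<nu> else 0)"
    unfolding h_def using less
    by (simp only: lookup_sum lookup_single when_def) (intro sum.cong; auto)
  also have "\<dots> \<noteq> 0"
    using lead_in_keys[OF f] by (simp add: in_keys_iff)
  finally have in_h: "g (lead r f) \<in> Poly_Mapping.keys h" by (simp add: in_keys_iff)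
  then show "h \<noteq> 0" by auto
  show "lead r h = g (lead r f)"
  proof (rule lead_eqI[OF in_h])
    fix \<rho> assume "\<rho> \<in> Poly_Mapping.keys h"
    then obtain \<nu> where \<nu>: "\<nu> \<in> Poly_Mapping.keys f" "\<rho> = g \<nu>"
      unfolding h_def by (fastforce dest: subsetD[OF keys_sum] split: if_splits)
    then show "(\<rho>, g (lead r f)) \<in> r"
      using less refl[OF closed[OF lead_in_NF[OF f]]] by (cases "\<nu> = lead r f") auto
  qed
qed

lemma bc_gen_mult_left:
  assumes "f \<in> BC X" "f \<noteq> 0" "z \<in> X"
  shows "bc_mult (bc_gen z) f \<noteq> 0" "lead r (bc_mult (bc_gen z) f) = nf_mult (Gen z) (lead r f)"
proof -
  have z: "Gen z \<in> NF X" using assms by (simp add: NF_def)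
  show "bc_mult (bc_gen z) f \<noteq> 0" "lead r (bc_mult (bc_gen z) f) = nf_mult (Gen z) (lead r f)"
    unfolding bc_mult_bc_gen_left
    by (rule lead_monotone_image[OF assms(1,2)];
        use monomial_order z in \<open>simp add: monomial_order_def nf_mult_NF\<close>)+
qed

lemma bc_gen_mult_right:
  assumes "f \<in> BC X" "f \<noteq> 0" "z \<in> X"
  shows "bc_mult f (bc_gen z) \<noteq> 0" "lead r (bc_mult f (bc_gen z)) = nf_mult (lead r f) (Gen z)"
proof -
  have z: "Gen z \<in> NF X" using assms by (simp add: NF_def)
  show "bc_mult f (bc_gen z) \<noteq> 0" "lead r (bc_mult f (bc_gen z)) = nf_mult (lead r f) (Gen z)"
    unfolding bc_mult_bc_gen_right
    by (rule lead_monotone_image[OF assms(1,2)];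
        use monomial_order z in \<open>simp add: monomial_order_def nf_mult_NF\<close>)+
qed

text \<open>Multiplying \<open>Br u v\<close> by a generator on the right extends only
  \<open>v\<close>. The form of \<open>lead r f\<close> is assumed because a monomial
  \<open>Gen x\<close> has no components to extend.\<close>

lemma foldl_bc_gen:
  assumes "f \<in> BC X" "f \<noteq> 0" "lead r f = Br u v" "set ys \<subseteq> X"
  defines "h \<equiv> foldl bc_mult f (map bc_gen ys)"
  shows "h \<in> BC X \<and> h \<noteq> 0 \<and> lead r h = Br u (v + mset ys)"
  using assms(1-4) unfolding h_def
  by (induction ys arbitrary: f v) (simp_all add: bc_gen_mult_right BC_mult_closed BC_gen)

lemma foldr_bc_gen:
  assumes "f \<in> BC X" "f \<noteq> 0" "lead r f = Br u v" "set zs \<subseteq> X"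
  defines "h \<equiv> foldr bc_mult (map bc_gen zs) f"
  shows "h \<in> BC X \<and> h \<noteq> 0 \<and> lead r h = Br (u + mset zs) v"
  using assms(1-4) unfolding h_def
  by (induction zs) (simp_all add: bc_gen_mult_left BC_mult_closed BC_gen)

text \<open>Shows that the brackets built from \<open>f\<close> realise as leading monomials all
  multiples of \<open>Br u v\<close>, with arbitrary letters of \<open>X\<close> added to each
  component.\<close>

lemma lead_normal_poly:
  assumes "f \<in> BC X" "f \<noteq> 0" "lead r f = Br u v" "set zs \<subseteq> X" "set ys \<subseteq> X"
  defines "h \<equiv> rbracket bc_mult (map bc_gen zs @ [lbracket bc_mult (f # map bc_gen ys)])"
  shows "h \<noteq> 0" "lead r h = Br (u + mset zs) (v + mset ys)"
proof -
  have "foldl bc_mult f (map bc_gen ys) \<in> BC X" "foldl bc_mult f (map bc_gen ys) \<noteq> 0"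
      "lead r (foldl bc_mult f (map bc_gen ys)) = Br u (v + mset ys)"
    using foldl_bc_gen[OF assms(1-3,5)] by simp_all
  from foldr_bc_gen[OF this assms(4)]
  show "h \<noteq> 0" "lead r h = Br (u + mset zs) (v + mset ys)"
    by (simp_all add: h_def rbracket_snoc)
qed

section \<open>Reduction by leading monomials, monic representatives and membership in
  ideals\<close>

text \<open>Subtracting a multiple of \<open>h\<close> cancels the leading term of \<open>f\<close>.
  As \<open>h\<close> lies in \<open>I\<close>, the remainder stays in \<open>I\<close>, so
  well-founded induction puts it in \<open>J\<close>; as \<open>h\<close> lies in \<open>J\<close>,
  so does \<open>f\<close>.\<close>

lemma subspace_reduction:
  assumes I: "bcv.subspace I" "I \<subseteq> BC X" and J: "bcv.subspace J"
    and red: "\<And>f. f \<in> I \<Longrightarrow> f \<noteq> 0 \<Longrightarrow> \<exists>h\<in>I \<inter> J. h \<noteq> 0 \<and> lead r f = lead r h"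
  shows "I \<subseteq> J"
proof -
  have "f \<in> J" if "f \<in> I" "f \<noteq> 0" for f
    using that
  \<comment> \<open>The second conjunct of \<open>well_order_on_def\<close> is well-foundedness of
    the strict order \<open>r - Id\<close>.\<close>
  proof (induction "lead r f" arbitrary: f
      rule: wf_induct_rule[OF well_order[unfolded well_order_on_def, THEN conjunct2]])
    case (1 f)
    obtain h where h: "h \<in> I" "h \<in> J" "h \<noteq> 0" "lead r f = lead r h" using red 1(2,3) by blast
    define c where "c = Poly_Mapping.lookup f (lead r f) / Poly_Mapping.lookup h (lead r f)"
    define g where "g = f - bc_scale c h"
    have gI: "g \<in> I"
      unfolding g_def using I h 1 by (intro bcv.subspace_diff bcv.subspace_scale)
    have "Poly_Mapping.lookup h (lead r f) \<noteq> 0"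
      using lead_in_keys[of h] h I by (auto simp: in_keys_iff)
    then have no_lead: "lead r f \<notin> Poly_Mapping.keys g"
      by (simp add: g_def c_def in_keys_iff lookup_minus)
    have "g \<in> J"
    proof (cases "g = 0")
      case True
      then show ?thesis using J bcv.subspace_0 by blast
    next
      case False
      then have lg: "lead r g \<in> Poly_Mapping.keys g" using gI I lead_in_keys by blast
      then have "lead r g \<in> Poly_Mapping.keys f \<or> lead r g \<in> Poly_Mapping.keys h"
        by (auto simp: g_def in_keys_iff lookup_minus)
      then have "(lead r g, lead r f) \<in> r"
        using le_lead[of f] le_lead[of h] h I 1 by auto
      then have "(lead r g, lead r f) \<in> r - Id" using lg no_lead by auto
      then show ?thesis using 1(1) gI False by blast
    qed
    then have "g + bc_scale c h \<in> J"
      using J h by (intro bcv.subspace_add bcv.subspace_scale)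
    then show ?case by (simp add: g_def)
  qed
  then show ?thesis using J bcv.subspace_0 by blast
qed

text \<open>Divide by the leading coefficient, which is nonzero.\<close>

lemma monic_representative:
  assumes I: "BC_ideal X I" and f: "f \<in> I" "f \<noteq> 0"
  shows "\<exists>s\<in>I. s \<noteq> 0 \<and> Poly_Mapping.lookup s (lead r s) = 1 \<and> lead r s = lead r f"
proof -
  define c where "c = Poly_Mapping.lookup f (lead r f)"
  have "f \<in> BC X" using I f by (auto simp: BC_ideal_def)
  then have c: "c \<noteq> 0" using lead_in_keys f by (auto simp: c_def in_keys_iff)
  let ?s = "bc_scale (inverse c) f"
  have "?s \<in> I" using I f by (simp add: BC_ideal_def bcv.subspace_scale)
  moreover have "?s \<noteq> 0" using c f by simp
  moreover have "lead r ?s = lead r f" using c by (simp add: lead_scale)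
  moreover from this have "Poly_Mapping.lookup ?s (lead r ?s) = 1" using c by (simp add: c_def)
  ultimately show ?thesis by blast
qed

end

text \<open>Stated for any ideal containing \<open>S\<close>, so that it serves both for
  \<open>I\<close> and for the competing ideals in the hull that defines
  \<open>BC_Id X S\<close>.\<close>

lemma normal_polys_in_ideal:
  assumes J: "BC_ideal X J" and S: "S \<subseteq> J" and h: "h \<in> normal_polys X r S"
  shows "h \<in> J"
  using h
proof cases
  case (bracket s zs ys)
  have L: "foldl bc_mult f (map bc_gen us) \<in> J" if "f \<in> J" "set us \<subseteq> X" for f us
    using that J by (induction us arbitrary: f) (auto simp: BC_ideal_def BC_gen)
  have R: "foldr bc_mult (map bc_gen us) f \<in> J" if "f \<in> J" "set us \<subseteq> X" for f us
    using that J by (induction us) (auto simp: BC_ideal_def BC_gen)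
  show ?thesis using bracket S by (auto simp: rbracket_snoc intro!: L R)
qed (use S in blast)

section \<open>Construction of the finite basis\<close>

theorem theorem3p15:
  fixes X :: "'x set" and r :: "'x nf rel" and I :: "('x, 'k::field) bc set"
  assumes "finite X"
    and "monomial_order X r"
    and "BC_ideal X I"
  shows "\<exists>S. finite S \<and> GS_basis X r I S"
proof -
  interpret bc_monomial_order X r by unfold_locales fact
  have I: "bcv.subspace I" "I \<subseteq> BC X" using assms(3) by (simp_all add: BC_ideal_def)
  define L where "L = lead r ` (I - {0})"
  have L_NF: "L \<subseteq> NF X" using I lead_in_NF by (auto simp: L_def)
  then have "set_mset u \<subseteq> X \<and> set_mset v \<subseteq> X" if "Br u v \<in> L" for u v
    using that by (auto simp: NF_def)
  then obtain B where B: "B \<subseteq> {(u, v). Br u v \<in> L}" "finite B"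
      "\<forall>(u, v)\<in>{(u, v). Br u v \<in> L}. \<exists>(u', v')\<in>B. u' \<subseteq># u \<and> v' \<subseteq># v"
    using dickson_multiset_pairs[OF assms(1), of "{(u, v). Br u v \<in> L}"] by auto
  have "\<forall>\<mu>\<in>L. \<exists>s\<in>I. s \<noteq> 0 \<and> Poly_Mapping.lookup s (lead r s) = 1 \<and> lead r s = \<mu>"
    using monic_representative[OF assms(3)] by (auto simp: L_def)
  then obtain s where s: "\<And>\<mu>. \<mu> \<in> L \<Longrightarrow> s \<mu> \<in> I"
      "\<And>\<mu>. \<mu> \<in> L \<Longrightarrow> s \<mu> \<noteq> 0 \<and> Poly_Mapping.lookup (s \<mu>) (lead r (s \<mu>)) = 1"
      "\<And>\<mu>. \<mu> \<in> L \<Longrightarrow> lead r (s \<mu>) = \<mu>"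
    by metis
  \<comment> \<open>A basis element led by a generator has length 1 and contributes only itself as a
    normal polynomial, so all generators in \<open>L\<close> are kept; there are finitely many since
    \<open>X\<close> is finite.\<close>
  define M where "M = (L \<inter> Gen ` X) \<union> (\<lambda>(u, v). Br u v) ` B"
  have M_sub: "M \<subseteq> L" using B(1) by (auto simp: M_def)
  define S where "S = s ` M"
  have SI: "S \<subseteq> I" using s(1) M_sub by (auto simp: S_def)
  have reach: "\<exists>h\<in>normal_polys X r S. h \<noteq> 0 \<and> lead r f = lead r h" if "f \<in> I" "f \<noteq> 0" for f
  proof -
    have fL: "lead r f \<in> L" using that by (simp add: L_def)
    show ?thesis
    proof (cases "lead r f")
      case (Gen x)
      then have "lead r f \<in> M" using fL L_NF by (auto simp: M_def NF_def)
      then have "s (lead r f) \<in> normal_polys X r S" by (auto simp: S_def intro: normal_polys.base)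
      then show ?thesis using s fL by (metis (no_types))
    next
      case (Br u v)
      then obtain u' v' where uv': "(u', v') \<in> B" "u' \<subseteq># u" "v' \<subseteq># v" using B(3) fL by fastforce
      define t where "t = s (Br u' v')"
      have "Br u' v' \<in> M" using uv' by (force simp: M_def)
      then have M: "Br u' v' \<in> L" "t \<in> S" using M_sub by (auto simp: S_def t_def)
      have t: "t \<in> BC X" "t \<noteq> 0" "lead r t = Br u' v'" using s M I by (auto simp: t_def)
      \<comment> \<open>Both components are nonempty, which gives the length at least 2 demanded by
        the bracket rule.\<close>
      have "u' \<noteq> {#}" "v' \<noteq> {#}" using M(1) L_NF by (auto simp: NF_def)
      then have "size u' \<noteq> 0" "size v' \<noteq> 0" by simp_all
      then have len: "nf_length (lead r t) \<ge> 2" unfolding t(3) nf_length.simps by linarith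
      \<comment> \<open>The words list the letters missing from \<open>u'\<close> and
        \<open>v'\<close>; bracketing \<open>t\<close> with them raises its leading monomial to
        \<open>Br u v\<close>.\<close>
      obtain zs ys where zs: "mset zs = u - u'" and ys: "mset ys = v - v'" by (metis ex_mset)
      have "set_mset u \<subseteq> X" "set_mset v \<subseteq> X" using Br fL L_NF by (auto simp: NF_def)
      then have X: "set zs \<subseteq> X" "set ys \<subseteq> X"
        using zs ys by (metis in_diffD set_mset_mset subset_iff)+
      have "lead r f = Br (u' + mset zs) (v' + mset ys)"
        using Br uv' zs ys by (simp add: subset_mset.add_diff_inverse)
      then show ?thesis
        using normal_polys.bracket[OF M(2) len X] lead_normal_poly[OF t X] by metis
    qed
  qed
  \<comment> \<open>Minimality of \<open>I\<close> among the ideals containing \<open>S\<close>: the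
    normal polynomials given by \<open>reach\<close> lie in \<open>I\<close> and in
    \<open>J\<close>, so reduction applies.\<close>
  have "I \<subseteq> J" if J: "BC_ideal X J" "S \<subseteq> J" for J
  proof (rule subspace_reduction[OF I])
    show "bcv.subspace J" using J by (simp add: BC_ideal_def)
    show "\<exists>h\<in>I \<inter> J. h \<noteq> 0 \<and> lead r f = lead r h" if "f \<in> I" "f \<noteq> 0" for f
      using reach[OF that] normal_polys_in_ideal[OF assms(3) SI] normal_polys_in_ideal[OF J] by blast
  qed
  then have "BC_Id X S = I"
    unfolding BC_Id_def using assms(3) SI by (intro hull_unique) auto
  moreover have "monic_set r S" using s M_sub by (auto simp: monic_set_def S_def)
  moreover have "finite S" using assms(1) B(2) by (simp add: S_def M_def)
  ultimately have "finite S \<and> GS_basis X r I S"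
    using SI I reach by (simp add: GS_basis_def)
  then show ?thesis ..
qed

end
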